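(* Let $p$ be a prime and let $\mathcal{T}$ be a balanced and irreducible system of $L$ $\mathbb{F}_p$-equations in $r$ variables, with parameters $r_1,r_2$ and maximal multiplicity $m_{\mathcal{T}}$. Assume \[ \tfrac{1}{2}r_1+\tfrac{1}{e}r_2>L . \] Then there exists a constant $c_{\mathcal{T}}(p)<1$ with $c_{\mathcal{T}}(p)\leq \tilde{C}_{(r_1,r_2,L,m_{\mathcal{T}})}(p)/p$ such that for all $n\in\mathbb{N}$, \[ \mathrm{ex}_{\mathcal{T}}(n)\leq (c_{\mathcal{T}}(p)\cdot p)^n . \]
   Context: A system $\mathcal{T}$ of $L$ linear equations $\sum_{i=1}^r a_i^{(l)}x_i=0$ ($l\in[L]$) with coefficients $a_i^{(l)}\in\mathbb{F}_p$ (variables $x_i$ ranging over $\mathbb{F}_p^n$) is balanced if $\sum_{i=1}^r a_i^{(l)}=0$ for every $l$. For $A\subseteq\mathbb{F}_p^n$, a $\mathcal{T}$-semishape in $A$ is a solution $(x_1,\dots,x_r)\in A^r$; $A$ is strongly $\mathcal{T}$-free if every $\mathcal{T}$-semishape in $A$ satisfies $x_1=\cdots=x_r$, and $\mathrm{ex}_{\mathcal{T}}(n)$ is the maximum size of a strongly $\mathcal{T}$-free subset of $\mathbb{F}_p^n$. For $l\in[L]$ let $e_l=\{i\in[r]:a_i^{(l)}\neq 0\}$; the hypergraph $\mathcal{H}_{\mathcal{T}}$ has multiset of edges $\{e_l\}$ and vertex set $J=\bigcup_l e_l$. $\mathcal{T}$ is irreducible if $J=[r]$ and $\mathcal{H}_{\mathcal{T}}$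 is connected (any two vertices are joined by a sequence of vertices, consecutive ones lying in a common edge). The multiplicity of $x_i$ is $m_i=\#\{l: a_i^{(l)}\neq0\}$; $r_1=\#\{i:m_i=1\}$, $r_2=\#\{i:m_i\geq2\}$, $m_{\mathcal{T}}=\max_i m_i$. For $m,h\in\mathbb{N}$ and $\alpha>0$, let $G_{m,\alpha,h}(u)=u^{-\alpha h}(1+u+\cdots+u^{mh})$ on $(0,1]$ and $\Lambda_{m,\alpha,h}=\min_{u\in(0,1]}G_{m,\alpha,h}(u)$; set $\Lambda_{m,0,h}=1$. For $r_1,r_2\in\mathbb{Z}_{\geq0}$ not both zero, $L,m\in\mathbb{N}$ and $d\geq 2$, $\tilde{C}_{(r_1,r_2,L,m)}(d)=\inf\{\max\{\Lambda_{1,\alpha,d-1},\Lambda_{m,\beta,d-1}\}: r_1\alpha+r_2\beta=L,\ \alpha,\beta\geq0\}$. Here $e$ is the base of the natural logarithm. *)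

theory Defs
  imports
    "Jordan_Normal_Form.Matrix"
    "HOL-Library.Cardinality"
    "HOL-Library.FuncSet"
    "HOL-Library.Multiset"
    "HOL-Computational_Algebra.Primes"
    Complex_Main
begin

text \<open>
  A system of \<open>L\<close> linear equations in \<open>r\<close> variables over a field is given by its
  \<open>L \<times> r\<close> coefficient matrix. Equations and variables are indexed from \<open>0\<close>. The space of
  vectors of length \<open>n\<close> over the field is \<open>carrier_vec n\<close>, so that \<open>n\<close> is an ordinary
  natural number and one system can be considered for all \<open>n\<close> at once.
\<close>

definition balanced_system :: "'a::field mat \<Rightarrow> bool" where
  "balanced_system T \<longleftrightarrow> (\<forall>l<dim_row T. (\<Sum>i<dim_col T. T $$ (l, i)) = 0)"

definition semishape :: "'a::field mat \<Rightarrow> nat \<Rightarrow> 'a vec set \<Rightarrow> (nat \<Rightarrow> 'a vec) \<Rightarrow> bool" where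
  "semishape T n A x \<longleftrightarrow> x \<in> {..<dim_col T} \<rightarrow> A \<and>
     (\<forall>l<dim_row T.
        finsum_vec TYPE('a) n (\<lambda>i. T $$ (l, i) \<cdot>\<^sub>v x i) {..<dim_col T} = 0\<^sub>v n)"

definition strongly_free :: "'a::field mat \<Rightarrow> nat \<Rightarrow> 'a vec set \<Rightarrow> bool" where
  "strongly_free T n A \<longleftrightarrow>
     (\<forall>x. semishape T n A x \<longrightarrow> (\<forall>i<dim_col T. \<forall>j<dim_col T. x i = x j))"

text \<open>The field is finite, so \<open>Max\<close> is taken over a finite set (containing \<open>0 = card {}\<close>).\<close>

definition ex_free :: "'a::{field,finite} mat \<Rightarrow> nat \<Rightarrow> nat" where
  "ex_free T n = Max {card A |A. A \<subseteq> carrier_vec n \<and> strongly_free T n A}"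

definition eq_support :: "'a::field mat \<Rightarrow> nat \<Rightarrow> nat set" where
  "eq_support T l = {i. i < dim_col T \<and> T $$ (l, i) \<noteq> 0}"

definition system_edges :: "'a::field mat \<Rightarrow> nat set multiset" where
  "system_edges T = image_mset (eq_support T) (mset_set {..<dim_row T})"

definition system_vertices :: "'a::field mat \<Rightarrow> nat set" where
  "system_vertices T = (\<Union>l<dim_row T. eq_support T l)"

definition hypergraph_connected :: "'v set \<Rightarrow> 'v set multiset \<Rightarrow> bool" where
  "hypergraph_connected V E \<longleftrightarrow>
     (\<forall>u\<in>V. \<forall>v\<in>V. (u, v) \<in> {(a, b). \<exists>e\<in>#E. a \<in> e \<and> b \<in> e}\<^sup>*)"

definition irreducible_system :: "'a::field mat \<Rightarrow> bool" where
  "irreducible_system T \<longleftrightarrow> system_vertices T = {..<dim_col T} \<and>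
     hypergraph_connected (system_vertices T) (system_edges T)"

definition var_multiplicity :: "'a::field mat \<Rightarrow> nat \<Rightarrow> nat" where
  "var_multiplicity T i = card {l. l < dim_row T \<and> T $$ (l, i) \<noteq> 0}"

definition num_mult_one :: "'a::field mat \<Rightarrow> nat" where
  "num_mult_one T = card {i. i < dim_col T \<and> var_multiplicity T i = 1}"

definition num_mult_ge_two :: "'a::field mat \<Rightarrow> nat" where
  "num_mult_ge_two T = card {i. i < dim_col T \<and> var_multiplicity T i \<ge> 2}"

definition max_multiplicity :: "'a::field mat \<Rightarrow> nat" where
  "max_multiplicity T = Max (var_multiplicity T ` {..<dim_col T})"

definition G_fun :: "nat \<Rightarrow> real \<Rightarrow> nat \<Rightarrow> real \<Rightarrow> real" where
  "G_fun m \<alpha> h u = u powr (- \<alpha> * real h) * (\<Sum>k\<le>m * h. u ^ k)"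

text \<open>
  \<open>LEAST\<close> over the image is the minimum of the function; for \<open>\<alpha> > 0\<close> it is attained, as
  \<open>G_fun\<close> is continuous on \<open>{0<..1}\<close> and, if \<open>h > 0\<close>, tends to infinity at \<open>0\<close>.
\<close>

definition Lambda_min :: "nat \<Rightarrow> real \<Rightarrow> nat \<Rightarrow> real" where
  "Lambda_min m \<alpha> h = (if \<alpha> = 0 then 1 else (LEAST v. v \<in> G_fun m \<alpha> h ` {0<..1}))"

definition C_tilde :: "nat \<Rightarrow> nat \<Rightarrow> nat \<Rightarrow> nat \<Rightarrow> nat \<Rightarrow> real" where
  "C_tilde r1 r2 L m d =
     Inf {max (Lambda_min 1 \<alpha> (d - 1)) (Lambda_min m \<beta> (d - 1)) |\<alpha> \<beta>.
            real r1 * \<alpha> + real r2 * \<beta> = real L \<and> \<alpha> \<ge> 0 \<and> \<beta> \<ge> 0}"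

end

theory Submission
  imports Defs
begin

text \<open>
  Slice rank method. On a strongly free set \<open>A\<close>, the indicator of the solution set of the system
  is the diagonal tensor in \<open>r \<ge> 2\<close> variables, whose slice rank is \<open>card A\<close>. As a product of terms
  \<open>1 - (\<dots>) ^ (p - 1)\<close> the indicator is a polynomial of degree \<open>L * n * (p - 1)\<close>, and exponents can
  be reduced to at most \<open>p - 1\<close>. For weights \<open>\<alpha> i\<close> with sum \<open>L\<close>, every monomial has a variable \<open>x i\<close>
  of degree at most \<open>\<alpha> i * n * (p - 1)\<close>, so the slice rank is bounded by the number of such
  low-degree monomials in a single vector, which is at most \<open>G_fun 1 (\<alpha> i) (p - 1) u ^ n\<close> for each
  \<open>u \<in> {0<..1}\<close>. As \<open>1 / e < 1 / 2\<close>, all weights can be taken equal and below \<open>1 / 2\<close>; this makes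
  \<open>G_fun 1\<close> smaller than \<open>p\<close> at some \<open>u < 1\<close>.
\<close>

subsection \<open>Slice rank of diagonal tensors\<close>

text \<open>Pigeonhole: over a finite field the linear map \<open>\<phi>\<close> from functions on
  \<open>A\<close> to functions on the smaller set \<open>S\<close> is not injective, and the
  difference of two functions with equal image is a nonzero solution.\<close>

lemma underdetermined_solution:
  fixes f :: "'s \<Rightarrow> 'b \<Rightarrow> 'a::{field,finite}"
  assumes "finite A" "finite S" "card S < card A"
  obtains h where "\<And>a. a \<notin> A \<Longrightarrow> h a = 0" "\<exists>a\<in>A. h a \<noteq> 0"
    "\<And>s. s \<in> S \<Longrightarrow> (\<Sum>a\<in>A. h a * f s a) = 0"
proof -
  define \<phi> where "\<phi> h = (\<lambda>s\<in>S. \<Sum>a\<in>A. h a * f s a)" for h :: "'b \<Rightarrow> 'a"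
  have one: "CARD('a) > 1"
    using card_mono[of UNIV "{0::'a, 1}"] by simp
  have "card (\<phi> ` (A \<rightarrow>\<^sub>E UNIV)) \<le> card (S \<rightarrow>\<^sub>E (UNIV :: 'a set))"
    by (intro card_mono finite_PiE assms) (auto simp: \<phi>_def)
  also have "\<dots> < card (A \<rightarrow>\<^sub>E (UNIV :: 'a set))"
    using assms one by (simp add: card_PiE power_strict_increasing)
  finally have "\<not> inj_on \<phi> (A \<rightarrow>\<^sub>E UNIV)"
    by (rule pigeonhole)
  then obtain g k where gk: "g \<in> A \<rightarrow>\<^sub>E UNIV" "k \<in> A \<rightarrow>\<^sub>E UNIV" "\<phi> g = \<phi> k" "g \<noteq> k"
    by (auto simp: inj_on_def)
  show thesis
  proof
    show "(if a \<in> A then g a - k a else 0) = 0" if "a \<notin> A" for a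
      using that by simp
    show "\<exists>a\<in>A. (if a \<in> A then g a - k a else 0) \<noteq> 0"
      using gk PiE_ext[of g A "\<lambda>_. UNIV" k] by auto
    show "(\<Sum>a\<in>A. (if a \<in> A then g a - k a else 0) * f s a) = 0" if "s \<in> S" for s
      using fun_cong[OF gk(3), of s] that by (simp add: \<phi>_def left_diff_distrib sum_subtractf)
  qed
qed

text \<open>As long as the support \<open>B\<close> of a solution \<open>h\<close> is too small, the
  equations remain underdetermined on \<open>A - B\<close>. A nonzero solution there is added to
  \<open>h\<close>; the disjoint supports rule out cancellation.\<close>

lemma large_support_solution:
  fixes f :: "'s \<Rightarrow> 'b \<Rightarrow> 'a::{field,finite}"
  assumes "finite A" "finite S"
  obtains h where "\<And>s. s \<in> S \<Longrightarrow> (\<Sum>a\<in>A. h a * f s a) = 0"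
    "card A \<le> card {a \<in> A. h a \<noteq> 0} + card S"
proof -
  have "\<exists>h. (\<forall>s\<in>S. (\<Sum>a\<in>A. h a * f s a) = 0) \<and> k \<le> card {a \<in> A. h a \<noteq> 0}"
    if "k + card S \<le> card A" for k
    using that
  proof (induction k)
    case 0
    then show ?case by (intro exI[of _ "\<lambda>_. 0"]) simp
  next
    case (Suc k)
    then obtain h where h: "\<And>s. s \<in> S \<Longrightarrow> (\<Sum>a\<in>A. h a * f s a) = 0"
      and k: "k \<le> card {a \<in> A. h a \<noteq> 0}" by auto
    define B where "B = {a \<in> A. h a \<noteq> 0}"
    have B: "B \<subseteq> A" "finite B" using assms by (auto simp: B_def)
    show ?case
    proof (cases "Suc k \<le> card B")
      case True
      then show ?thesis using h by (auto simp: B_def)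
    next
      case False
      then have "card S < card (A - B)"
        using Suc.prems k B by (simp add: card_Diff_subset B_def)
      from underdetermined_solution[OF _ assms(2) this, of f] assms(1)
      obtain g where g: "\<And>a. a \<notin> A - B \<Longrightarrow> g a = 0" "\<exists>a\<in>A - B. g a \<noteq> 0"
        "\<And>s. s \<in> S \<Longrightarrow> (\<Sum>a\<in>A - B. g a * f s a) = 0" by auto
      from g(2) obtain a0 where a0: "a0 \<in> A - B" "g a0 \<noteq> 0" by auto
      have "insert a0 B \<subseteq> {a \<in> A. h a + g a \<noteq> 0}"
        using a0 B g(1) by (auto simp: B_def)
      then have "card (insert a0 B) \<le> card {a \<in> A. h a + g a \<noteq> 0}"
        using assms by (intro card_mono) auto
      moreover have "(\<Sum>a\<in>A. (h a + g a) * f s a) = 0" if "s \<in> S" for s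
      proof -
        have "(\<Sum>a\<in>A. g a * f s a) = (\<Sum>a\<in>A - B. g a * f s a)"
          using assms g(1) by (intro sum.mono_neutral_right) auto
        then show ?thesis
          using h g(3) that by (simp add: distrib_right sum.distrib)
      qed
      ultimately show ?thesis
        using a0 B k by (intro exI[of _ "\<lambda>a. h a + g a"]) (simp add: B_def)
    qed
  qed
  note * = this
  show thesis
  proof (cases "card S \<le> card A")
    case True
    then show ?thesis using *[of "card A - card S"] that by (auto simp: le_diff_conv)
  next
    case False
    then show ?thesis using that[of "\<lambda>_. 0"] by simp
  qed
qed

text \<open>Multiplying by \<open>h (x k)\<close> and summing over \<open>x k\<close> in
  \<open>A\<close> removes the variable \<open>k\<close>. The tensor stays diagonal, slices in
  direction \<open>k\<close> vanish because \<open>g k s\<close> ignores \<open>x k\<close> and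
  \<open>h\<close> is orthogonal to \<open>f k s\<close>, and all other slices stay slices.\<close>

lemma slice_contraction:
  fixes w h :: "'b \<Rightarrow> 'a::field"
  assumes fin: "finite I" "finite A" and k: "k \<in> I"
    and indep: "\<And>i s x b. i \<in> I \<Longrightarrow> s \<in> S i \<Longrightarrow> g i s (x(i := b)) = g i s x"
    and eq: "\<And>x. x \<in> I \<rightarrow> A \<Longrightarrow> (\<Sum>a\<in>A. w a * (\<Prod>i\<in>I. of_bool (x i = a)))
               = (\<Sum>i\<in>I. \<Sum>s\<in>S i. f i s (x i) * g i s x)"
    and orth: "\<And>s. s \<in> S k \<Longrightarrow> (\<Sum>a\<in>A. h a * f k s a) = 0"
    and x: "x \<in> I - {k} \<rightarrow> A"
  shows "(\<Sum>a\<in>A. w a * h a * (\<Prod>i\<in>I - {k}. of_bool (x i = a)))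
    = (\<Sum>i\<in>I - {k}. \<Sum>s\<in>S i. f i s (x i) * (\<Sum>b\<in>A. h b * g i s (x(k := b))))"
proof -
  have I: "(\<Prod>i\<in>I. u i) = u k * (\<Prod>i\<in>I - {k}. u i)" "(\<Sum>i\<in>I. u i) = u k + (\<Sum>i\<in>I - {k}. u i)"
    for u :: "_ \<Rightarrow> 'a"
    using fin k by (auto intro: prod.remove sum.remove)
  have "(\<Sum>a\<in>A. w a * h a * (\<Prod>i\<in>I - {k}. of_bool (x i = a)))
      = (\<Sum>b\<in>A. \<Sum>a\<in>A. if b = a then h b * w a * (\<Prod>i\<in>I - {k}. of_bool (x i = a)) else 0)"
    using fin by (simp add: sum.delta' mult_ac)
  also have "\<dots> = (\<Sum>b\<in>A. h b * (\<Sum>a\<in>A. w a * (\<Prod>i\<in>I. of_bool ((x(k := b)) i = a))))"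
    by (auto simp: I sum_distrib_left mult_ac intro!: sum.cong)
  also have "\<dots> = (\<Sum>b\<in>A. h b * (\<Sum>i\<in>I. \<Sum>s\<in>S i. f i s ((x(k := b)) i) * g i s (x(k := b))))"
    using x by (intro sum.cong refl arg_cong2[of _ _ _ _ "(*)"] eq) (auto simp: Pi_iff)
  also have "\<dots> = (\<Sum>b\<in>A. h b * (\<Sum>s\<in>S k. f k s b * g k s x))
      + (\<Sum>b\<in>A. \<Sum>i\<in>I - {k}. \<Sum>s\<in>S i. f i s (x i) * (h b * g i s (x(k := b))))"
    using k by (simp add: I(2) indep distrib_left sum.distrib sum_distrib_left mult_ac)
  also have "(\<Sum>b\<in>A. h b * (\<Sum>s\<in>S k. f k s b * g k s x))
      = (\<Sum>s\<in>S k. (\<Sum>b\<in>A. h b * f k s b) * g k s x)"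
    unfolding sum_distrib_left sum_distrib_right by (subst sum.swap) (simp add: mult_ac)
  also have "\<dots> = 0" using orth by simp
  also have "(\<Sum>b\<in>A. \<Sum>i\<in>I - {k}. \<Sum>s\<in>S i. f i s (x i) * (h b * g i s (x(k := b))))
      = (\<Sum>i\<in>I - {k}. \<Sum>s\<in>S i. f i s (x i) * (\<Sum>b\<in>A. h b * g i s (x(k := b))))"
    by (subst sum.swap, intro sum.cong refl, subst sum.swap) (simp add: sum_distrib_left)
  finally show ?thesis by simp
qed

text \<open>Tao's bound, by induction on the number of variables: contracting variable
  \<open>k\<close> with a vector of large support costs at most \<open>card (S k)\<close> diagonal
  entries. The weights \<open>w\<close> are general because each contraction multiplies them by
  \<open>h\<close>.\<close>

lemma slice_rank_diagonal:
  fixes w :: "'b \<Rightarrow> 'a::{field,finite}" and f :: "'i \<Rightarrow> 's \<Rightarrow> 'b \<Rightarrow> 'a"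
  assumes "finite I" "card I \<ge> 2" "finite A" "\<And>i. i \<in> I \<Longrightarrow> finite (S i)"
    and "\<And>a. a \<in> A \<Longrightarrow> w a \<noteq> 0"
    and "\<And>i s x b. i \<in> I \<Longrightarrow> s \<in> S i \<Longrightarrow> g i s (x(i := b)) = g i s x"
    and "\<And>x. x \<in> I \<rightarrow> A \<Longrightarrow> (\<Sum>a\<in>A. w a * (\<Prod>i\<in>I. of_bool (x i = a)))
               = (\<Sum>i\<in>I. \<Sum>s\<in>S i. f i s (x i) * g i s x)"
  shows "card A \<le> (\<Sum>i\<in>I. card (S i))"
  using assms
proof (induction "card I - 2" arbitrary: I A w g)
  case 0
  then have "card I = 2" by simp
  then obtain k l where I: "I = {k, l}" "k \<noteq> l" by (meson card_2_iff)
  show ?case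
  proof (rule ccontr)
    assume "\<not> ?thesis"
    then have card: "card (S k <+> S l) < card A"
      using 0 I by (simp add: card_Plus)
    then obtain a0 where "a0 \<in> A" by fastforce
    define x0 where "x0 = (\<lambda>_::'i. a0)"
    have fin: "finite (S k <+> S l)" using 0(5) I by simp
    \<comment> \<open>With two variables the tensor is a diagonal matrix. If there are too few
      slices, some nonzero \<open>h\<close> is orthogonal to all of them at once: to
      \<open>f k s\<close>, and to \<open>g l s\<close> read as a function of coordinate
      \<open>k\<close>. Contraction with it then forces \<open>w c * h c = 0\<close> for every
      \<open>c\<close>.\<close>
    obtain h where h: "\<exists>a\<in>A. h a \<noteq> 0"
      "\<And>s. s \<in> S k <+> S l \<Longrightarrow>
         (\<Sum>a\<in>A. h a * (case s of Inl s \<Rightarrow> f k s a | Inr s \<Rightarrow> g l s (x0(k := a)))) = 0"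
      by (rule underdetermined_solution[OF \<open>finite A\<close> fin card,
          of "\<lambda>s a. case s of Inl s \<Rightarrow> f k s a | Inr s \<Rightarrow> g l s (x0(k := a))"]) blast
    have k: "(\<Sum>a\<in>A. h a * f k s a) = 0" if "s \<in> S k" for s
      using h(2)[of "Inl s"] that by auto
    have l: "(\<Sum>a\<in>A. h a * g l s (x0(k := a))) = 0" if "s \<in> S l" for s
      using h(2)[of "Inr s"] that by auto
    have gl: "g l s (x(l := b)) = g l s x" if "s \<in> S l" for s x b
      using 0(7) I that by blast
    have "w c * h c = 0" if c: "c \<in> A" for c
    proof -
      have Ik: "I - {k} = {l}" using I by auto
      have x: "x0(l := c) \<in> I - {k} \<rightarrow> A" using c Ik by auto
      have "(\<Sum>a\<in>A. w a * h a * (\<Prod>i\<in>I - {k}. of_bool ((x0(l := c)) i = a)))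
        = (\<Sum>i\<in>I - {k}. \<Sum>s\<in>S i. f i s ((x0(l := c)) i)
             * (\<Sum>b\<in>A. h b * g i s ((x0(l := c))(k := b))))"
        by (rule slice_contraction[where S = S and f = f, OF \<open>finite I\<close> \<open>finite A\<close> _ 0(7,8) k x])
          (use I in auto)
      also have "\<dots> = (\<Sum>s\<in>S l. f l s c * (\<Sum>b\<in>A. h b * g l s (x0(k := b))))"
        using I by (simp add: Ik gl fun_upd_twist[of l k])
      also have "\<dots> = 0" using l by simp
      also have "(\<Sum>a\<in>A. w a * h a * (\<Prod>i\<in>I - {k}. of_bool ((x0(l := c)) i = a)))
        = (\<Sum>a\<in>A. if c = a then w a * h a else 0)"
        by (intro sum.cong) (auto simp: Ik)
      finally show ?thesis using c \<open>finite A\<close> by simp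
    qed
    then show False using h(1) 0(6) by auto
  qed
next
  case (Suc n)
  then obtain k where k: "k \<in> I" by fastforce
  obtain h where h: "\<And>s. s \<in> S k \<Longrightarrow> (\<Sum>a\<in>A. h a * f k s a) = 0"
    and card: "card A \<le> card {a \<in> A. h a \<noteq> 0} + card (S k)"
    using large_support_solution[OF \<open>finite A\<close> Suc(6)[OF k], of "f k"] by auto
  \<comment> \<open>The new weights \<open>w a * h a\<close> are nonzero exactly on this support,
    and restricting the diagonal sum to it drops only zero terms.\<close>
  define B where "B = {a \<in> A. h a \<noteq> 0}"
  define g' where "g' i s x = (\<Sum>b\<in>A. h b * g i s (x(k := b)))" for i s x
  have "card B \<le> (\<Sum>i\<in>I - {k}. card (S i))"
  proof (rule Suc(1)[where w = "\<lambda>a. w a * h a" and g = g'])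
    show "n = card (I - {k}) - 2" "2 \<le> card (I - {k})" using Suc(2) k by simp_all
    show "finite (I - {k})" "finite B" using Suc by (auto simp: B_def)
    show "finite (S i)" if "i \<in> I - {k}" for i using Suc that by auto
    show "w a * h a \<noteq> 0" if "a \<in> B" for a using Suc that by (auto simp: B_def)
    show "g' i s (x(i := b)) = g' i s x" if "i \<in> I - {k}" "s \<in> S i" for i s x b
      using that Suc(8)[of i s] by (simp add: g'_def fun_upd_twist[of i k])
    show "(\<Sum>a\<in>B. w a * h a * (\<Prod>i\<in>I - {k}. of_bool (x i = a)))
        = (\<Sum>i\<in>I - {k}. \<Sum>s\<in>S i. f i s (x i) * g' i s x)" if "x \<in> I - {k} \<rightarrow> B" for x
    proof -
      have x: "x \<in> I - {k} \<rightarrow> A" using that by (auto simp: B_def)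
      have "(\<Sum>a\<in>B. w a * h a * (\<Prod>i\<in>I - {k}. of_bool (x i = a)))
         = (\<Sum>a\<in>A. w a * h a * (\<Prod>i\<in>I - {k}. of_bool (x i = a)))"
        using Suc by (intro sum.mono_neutral_left) (auto simp: B_def)
      then show ?thesis
        using slice_contraction[where S = S and f = f, OF \<open>finite I\<close> \<open>finite A\<close> k Suc(8,9) h x]
        by (simp add: g'_def fun_upd_def)
    qed
  qed
  then show ?case
    using card Suc.prems k by (simp add: B_def sum.remove)
qed

subsection \<open>Polynomial functions over finite fields\<close>

text \<open>Multiplication by \<open>y\<close> permutes the nonzero elements, so the factor
  \<open>y ^ (CARD('a) - 1)\<close> leaves their product unchanged.\<close>

lemma finite_field_power_card_minus_one:
  fixes y :: "'a::{field,finite}"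
  assumes "y \<noteq> 0"
  shows "y ^ (CARD('a) - 1) = 1"
proof -
  have "(\<Prod>z\<in>UNIV - {0}. y * z) = \<Prod>(UNIV - {0})"
    by (rule prod.reindex_bij_witness[where i = "\<lambda>z. z / y" and j = "\<lambda>z. y * z"])
      (use assms in auto)
  moreover have "\<Prod>(UNIV - {0::'a}) \<noteq> 0" by simp
  ultimately show ?thesis
    by (simp add: prod.distrib card_Diff_subset)
qed

lemma reduced_exponent:
  obtains k' where "k' \<le> k" "k' \<le> CARD('a) - 1" "\<And>y::'a::{field,finite}. y ^ k = y ^ k'"
proof -
  have two: "CARD('a) \<ge> 2"
    using card_mono[of UNIV "{0::'a, 1}"] by simp
  have "\<exists>k'\<le>k. k' \<le> CARD('a) - 1 \<and> (\<forall>y::'a. y ^ k = y ^ k')"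
  proof (induction k rule: less_induct)
    case (less k)
    show ?case
    proof (cases "k \<le> CARD('a) - 1")
      case False
      define d where "d = k - CARD('a)"
      \<comment> \<open>The exponent \<open>Suc d\<close> that remains is positive, so that the
        reduction also holds at \<open>y = 0\<close>.\<close>
      have k: "k = Suc d + (CARD('a) - 1)" using False two by (simp add: d_def)
      have red: "y ^ k = y ^ Suc d" for y :: 'a
        using finite_field_power_card_minus_one[of y]
        unfolding k power_add by (cases "y = 0") auto
      have "Suc d < k" using k two by simp
      from less[OF this] show ?thesis
        using red \<open>Suc d < k\<close> by (metis less_or_eq_imp_le order_trans)
    qed auto
  qed
  then show thesis using that by blast
qed

text \<open>Functions of total degree at most \<open>D\<close> in \<open>r * n\<close> coordinates.
  Generating them from monomials by addition lets slice decompositions be built monomial by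
  monomial; functions, unlike formal polynomials, allow exponents to be reduced.\<close>

inductive poly_fun :: "nat \<Rightarrow> nat \<Rightarrow> nat \<Rightarrow> ((nat \<Rightarrow> 'a::comm_ring_1 vec) \<Rightarrow> 'a) \<Rightarrow> bool"
  for r n D where
  monom: "(\<Sum>i<r. \<Sum>j<n. e i j) \<le> D \<Longrightarrow>
    poly_fun r n D (\<lambda>x. c * (\<Prod>i<r. \<Prod>j<n. (x i $ j) ^ e i j))"
| add: "poly_fun r n D f \<Longrightarrow> poly_fun r n D g \<Longrightarrow> poly_fun r n D (\<lambda>x. f x + g x)"

lemma poly_fun_const: "poly_fun r n D (\<lambda>_. c)"
  using poly_fun.monom[where r = r and n = n and D = D and c = c and e = "\<lambda>_ _. 0"] by simp

lemma poly_fun_coord: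
  assumes "i < r" "j < n"
  shows "poly_fun r n 1 (\<lambda>x. c * x i $ j)"
proof -
  let ?e = "\<lambda>i' j'. of_bool (i' = i \<and> j' = j)"
  have "(\<Sum>i'<r. \<Sum>j'<n. ?e i' j') = (\<Sum>i'<r. if i' = i then \<Sum>j'<n. of_bool (j' = j) else 0 :: nat)"
    by (intro sum.cong) auto
  also have "\<dots> = 1" using assms by (simp add: of_bool_def)
  finally have deg: "(\<Sum>i'<r. \<Sum>j'<n. ?e i' j') = (1 :: nat)" .
  have "(\<Prod>i'<r. \<Prod>j'<n. (x i' $ j') ^ ?e i' j') = x i $ j" for x :: "nat \<Rightarrow> 'a vec"
  proof -
    have "(\<Prod>i'<r. \<Prod>j'<n. (x i' $ j') ^ ?e i' j')
      = (\<Prod>i'<r. if i' = i then \<Prod>j'<n. if j' = j then x i $ j' else 1 else 1)"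
      by (intro prod.cong refl) (auto simp: of_bool_def if_distrib[of "power _"] cong: if_cong)
    also have "\<dots> = x i $ j"
      using assms by (simp only: prod.delta finite_lessThan lessThan_iff if_True)
    finally show ?thesis .
  qed
  then show ?thesis
    using poly_fun.monom[where r = r and n = n and D = 1 and c = c and e = ?e] deg by simp
qed

lemma poly_fun_sum:
  "finite K \<Longrightarrow> (\<And>k. k \<in> K \<Longrightarrow> poly_fun r n D (f k)) \<Longrightarrow> poly_fun r n D (\<lambda>x. \<Sum>k\<in>K. f k x)"
  by (induction K rule: finite_induct) (auto intro: poly_fun_const poly_fun.add)

lemma poly_fun_mult:
  assumes "poly_fun r n D f" "poly_fun r n D' g"
  shows "poly_fun r n (D + D') (\<lambda>x. f x * g x)"
  using assms
proof (induction rule: poly_fun.induct)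
  case (monom e c)
  show ?case
    using monom(2)
  proof (induction rule: poly_fun.induct)
    case (monom e' c')
    have "(\<Sum>i<r. \<Sum>j<n. e i j + e' i j) \<le> D + D'"
      using monom \<open>(\<Sum>i<r. \<Sum>j<n. e i j) \<le> D\<close> by (simp add: sum.distrib)
    from poly_fun.monom[where c = "c * c'", OF this] show ?case
      by (simp add: power_add prod.distrib mult_ac)
  next
    case (add f g)
    then show ?case by (simp add: distrib_left poly_fun.add)
  qed
next
  case (add f g)
  then show ?case by (simp add: distrib_right poly_fun.add)
qed

lemma poly_fun_prod:
  "finite K \<Longrightarrow> (\<And>k. k \<in> K \<Longrightarrow> poly_fun r n (D k) (f k)) \<Longrightarrow>
    poly_fun r n (\<Sum>k\<in>K. D k) (\<lambda>x. \<Prod>k\<in>K. f k x)"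
  by (induction K rule: finite_induct) (auto intro: poly_fun_const poly_fun_mult)

lemma poly_fun_power: "poly_fun r n D f \<Longrightarrow> poly_fun r n (k * D) (\<lambda>x. f x ^ k)"
  by (induction k) (auto intro: poly_fun_const poly_fun_mult)

lemma poly_fun_minus:
  assumes "poly_fun r n D f" "poly_fun r n D g"
  shows "poly_fun r n D (\<lambda>x. f x - g x)"
proof -
  have "poly_fun r n D (\<lambda>x. - g x)"
    using poly_fun_mult[OF poly_fun_const[of r n 0 "- 1"] assms(2)] by simp
  from poly_fun.add[OF assms(1) this] show ?thesis by simp
qed

section \<open>The solution set as a polynomial, and its slices\<close>

definition solution_indicator :: "'a::{field,finite} mat \<Rightarrow> nat \<Rightarrow> (nat \<Rightarrow> 'a vec) \<Rightarrow> 'a" where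
  "solution_indicator T n x =
     (\<Prod>l<dim_row T. \<Prod>j<n. 1 - (\<Sum>i<dim_col T. T $$ (l, i) * x i $ j) ^ (CARD('a) - 1))"

text \<open>\<open>y ^ (CARD('a) - 1)\<close> is 0 at \<open>y = 0\<close> and 1 elsewhere, so each
  factor tests whether one coordinate of one equation vanishes.\<close>

lemma solution_indicator_eq:
  fixes T :: "'a::{field,finite} mat"
  shows "solution_indicator T n x =
    of_bool (\<forall>l<dim_row T. \<forall>j<n. (\<Sum>i<dim_col T. T $$ (l, i) * x i $ j) = 0)"
proof -
  have "CARD('a) - 1 > 0"
    using card_mono[of UNIV "{0::'a, 1}"] by simp
  then have "1 - y ^ (CARD('a) - 1) = of_bool (y = 0)" for y :: 'a
    using finite_field_power_card_minus_one[of y] by (cases "y = 0") auto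
  then show ?thesis
    by (auto simp: solution_indicator_def)
qed

lemma poly_fun_solution_indicator:
  fixes T :: "'a::{field,finite} mat"
  shows "poly_fun (dim_col T) n (dim_row T * n * (CARD('a) - 1)) (solution_indicator T n)"
proof -
  have "poly_fun (dim_col T) n (\<Sum>l<dim_row T. \<Sum>j<n. (CARD('a) - 1) * 1) (solution_indicator T n)"
    unfolding solution_indicator_def[abs_def]
    by (intro poly_fun_prod finite_lessThan poly_fun_minus poly_fun_const poly_fun_power
        poly_fun_sum poly_fun_coord) auto
  then show ?thesis by (simp add: mult_ac)
qed

text \<open>Exponent vectors of the reduced monomials in one vector of length \<open>n\<close> whose
  degree is at most \<alpha> times the maximum \<open>n * h\<close>. Taking extensional functions
  makes \<open>card\<close> count each monomial once.\<close>

definition low_exponents :: "nat \<Rightarrow> nat \<Rightarrow> real \<Rightarrow> (nat \<Rightarrow> nat) set" where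
  "low_exponents h n \<alpha> = {t \<in> {..<n} \<rightarrow>\<^sub>E {..h}. real (\<Sum>j<n. t j) \<le> \<alpha> * real n * real h}"

lemma finite_low_exponents: "finite (low_exponents h n \<alpha>)"
  unfolding low_exponents_def by (rule finite_subset[of _ "{..<n} \<rightarrow>\<^sub>E {..h}"]) (auto intro: finite_PiE)

text \<open>A monomial fits into a single slice: if every variable had degree above its share of the
  bound, the total would exceed \<open>D\<close>. The index sets do not depend on \<open>f\<close>,
  so decompositions of summands combine by adding the cofactors \<open>g\<close>.\<close>

lemma poly_fun_slices:
  fixes f :: "(nat \<Rightarrow> 'a::{field,finite} vec) \<Rightarrow> 'a" and \<alpha> :: "nat \<Rightarrow> real"
  assumes "poly_fun r n D f" and "r > 0"
    and D: "real D \<le> (\<Sum>i<r. \<alpha> i) * real n * real (CARD('a) - 1)"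
  shows "\<exists>g. (\<forall>i t x v. g i t (x(i := v)) = g i t x) \<and>
    (\<forall>x. f x = (\<Sum>i<r. \<Sum>t\<in>low_exponents (CARD('a) - 1) n (\<alpha> i). (\<Prod>j<n. (x i $ j) ^ t j) * g i t x))"
  using assms(1)
proof (induction rule: poly_fun.induct)
  case (monom e c)
  let ?h = "CARD('a) - 1"
  have "\<exists>k'. k' \<le> e i j \<and> k' \<le> ?h \<and> (\<forall>y::'a. y ^ e i j = y ^ k')" for i j
    by (meson reduced_exponent)
  then obtain e' where e': "\<And>i j. e' i j \<le> e i j" "\<And>i j. e' i j \<le> ?h"
    "\<And>i j y. (y::'a) ^ e i j = y ^ e' i j" by metis
  have "\<exists>i<r. real (\<Sum>j<n. e' i j) \<le> \<alpha> i * real n * real ?h"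
  proof (rule ccontr)
    assume "\<not> ?thesis"
    then have "(\<Sum>i<r. \<alpha> i * real n * real ?h) < (\<Sum>i<r. real (\<Sum>j<n. e' i j))"
      using \<open>r > 0\<close> by (intro sum_strict_mono) auto
    also have "\<dots> \<le> real (\<Sum>i<r. \<Sum>j<n. e i j)"
      unfolding of_nat_sum by (intro sum_mono) (simp add: e')
    also have "\<dots> \<le> real D" using monom by (simp only: of_nat_le_iff)
    finally show False using D by (simp add: sum_distrib_right)
  qed
  then obtain k where k: "k < r" "real (\<Sum>j<n. e' k j) \<le> \<alpha> k * real n * real ?h" by blast
  define t0 where "t0 = (\<lambda>j\<in>{..<n}. e' k j)"
  have t0: "t0 \<in> low_exponents ?h n (\<alpha> k)"
    using k e' by (auto simp: low_exponents_def t0_def)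
  define g where "g i t x = (if i = k \<and> t = t0 then
      c * (\<Prod>i\<in>{..<r} - {k}. \<Prod>j<n. (x i $ j) ^ e' i j) else 0)" for i t and x :: "nat \<Rightarrow> 'a vec"
  show ?case
  proof (intro exI[of _ g] conjI allI)
    show "g i t (x(i := v)) = g i t x" for i t x v
      by (auto simp: g_def intro!: prod.cong)
    show "c * (\<Prod>i<r. \<Prod>j<n. (x i $ j) ^ e i j)
      = (\<Sum>i<r. \<Sum>t\<in>low_exponents ?h n (\<alpha> i). (\<Prod>j<n. (x i $ j) ^ t j) * g i t x)" for x
    proof -
      have "(\<Sum>i<r. \<Sum>t\<in>low_exponents ?h n (\<alpha> i). (\<Prod>j<n. (x i $ j) ^ t j) * g i t x)
        = (\<Sum>i<r. if i = k then \<Sum>t\<in>low_exponents ?h n (\<alpha> k). if t = t0 then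
            (\<Prod>j<n. (x k $ j) ^ t0 j) * g k t0 x else 0 else 0)"
        by (intro sum.cong) (auto simp: g_def intro!: sum.cong)
      also have "\<dots> = (\<Prod>j<n. (x k $ j) ^ t0 j) * g k t0 x"
        using k t0 by (simp add: finite_low_exponents)
      also have "\<dots> = c * ((\<Prod>j<n. (x k $ j) ^ e' k j) *
          (\<Prod>i\<in>{..<r} - {k}. \<Prod>j<n. (x i $ j) ^ e' i j))"
        by (simp add: g_def t0_def)
      also have "\<dots> = c * (\<Prod>i<r. \<Prod>j<n. (x i $ j) ^ e i j)"
        using k by (simp add: e'(3) prod.remove[of "{..<r}" k])
      finally show ?thesis by simp
    qed
  qed
next
  case (add f f')
  let ?h = "CARD('a) - 1"
  from add.IH(1) obtain g where g: "\<forall>i t x v. g i t (x(i := v)) = g i t x"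
    "\<forall>x. f x = (\<Sum>i<r. \<Sum>t\<in>low_exponents ?h n (\<alpha> i). (\<Prod>j<n. (x i $ j) ^ t j) * g i t x)"
    by blast
  from add.IH(2) obtain g' where g': "\<forall>i t x v. g' i t (x(i := v)) = g' i t x"
    "\<forall>x. f' x = (\<Sum>i<r. \<Sum>t\<in>low_exponents ?h n (\<alpha> i). (\<Prod>j<n. (x i $ j) ^ t j) * g' i t x)"
    by blast
  show ?case
    using g g' by (intro exI[of _ "\<lambda>i t x. g i t x + g' i t x"]) (simp add: fun_upd_def sum.distrib distrib_left)
qed

subsection \<open>The functions \<open>G\<close> and \<open>\<Lambda>\<close>\<close>

text \<open>A Chernoff bound: as \<open>u \<le> 1\<close>, each low exponent vector adds at least
  \<open>u powr (\<alpha> * n * h)\<close> to the sum of \<open>u\<close> to the degree over all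
  exponent vectors, and this sum factors over the coordinates.\<close>

lemma card_low_exponents_le:
  assumes "0 < u" "u \<le> 1"
  shows "real (card (low_exponents h n \<alpha>)) \<le> G_fun 1 \<alpha> h u ^ n"
proof -
  let ?\<Sigma> = "\<lambda>t. \<Sum>j<n. t j"
  have "real (card (low_exponents h n \<alpha>)) * u powr (\<alpha> * real n * real h)
    = (\<Sum>t\<in>low_exponents h n \<alpha>. u powr (\<alpha> * real n * real h))" by simp
  also have "\<dots> \<le> (\<Sum>t\<in>low_exponents h n \<alpha>. u ^ ?\<Sigma> t)"
  proof (intro sum_mono)
    fix t assume "t \<in> low_exponents h n \<alpha>"
    then have "u powr (\<alpha> * real n * real h) \<le> u powr real (?\<Sigma> t)"
      using assms by (intro powr_mono') (auto simp: low_exponents_def)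
    then show "u powr (\<alpha> * real n * real h) \<le> u ^ ?\<Sigma> t"
      using assms by (simp only: powr_realpow)
  qed
  also have "\<dots> \<le> (\<Sum>t\<in>{..<n} \<rightarrow>\<^sub>E {..h}. u ^ ?\<Sigma> t)"
    using assms by (intro sum_mono2 finite_PiE) (auto simp: low_exponents_def)
  also have "\<dots> = (\<Sum>k\<le>h. u ^ k) ^ n"
    by (subst prod_sum_PiE[symmetric, where f = "\<lambda>_ k. u ^ k", simplified power_sum[symmetric]]) auto
  finally have "real (card (low_exponents h n \<alpha>)) \<le>
      (\<Sum>k\<le>h. u ^ k) ^ n / u powr (\<alpha> * real n * real h)"
    using assms by (simp add: pos_le_divide_eq)
  also have "u powr (\<alpha> * real n * real h) = (u powr (\<alpha> * real h)) ^ n"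
    using assms by (simp add: powr_power mult_ac)
  also have "(\<Sum>k\<le>h. u ^ k) ^ n / \<dots> = G_fun 1 \<alpha> h u ^ n"
    by (simp add: G_fun_def powr_minus_divide flip: power_divide)
  finally show ?thesis .
qed

lemma Lambda_min_attained:
  assumes "\<alpha> > 0" "h > 0"
  obtains u where "0 < u" "u \<le> 1" "Lambda_min m \<alpha> h = G_fun m \<alpha> h u"
proof -
  let ?G = "G_fun m \<alpha> h"
  have G1: "?G 1 = real (m * h) + 1" by (simp add: G_fun_def)
  \<comment> \<open>Chosen so that \<open>\<delta> powr (- \<alpha> * h) = ?G 1\<close>. To the left
    of \<delta> the term for \<open>k = 0\<close> alone is at least \<open>?G 1\<close>, so the
    minimum over the compact interval from \<delta> to 1 is global.\<close>
  define \<delta> where "\<delta> = ?G 1 powr (- 1 / (\<alpha> * real h))"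
  have \<delta>: "0 < \<delta>" "\<delta> \<le> 1"
    using assms G1 powr_mono[of "- 1 / (\<alpha> * real h)" 0 "real (m * h) + 1"]
    unfolding \<delta>_def G1 by (auto simp del: of_nat_mult)
  have cont: "continuous_on {\<delta>..1} ?G"
    unfolding G_fun_def[abs_def] using \<delta> by (intro continuous_intros) auto
  obtain u where u: "u \<in> {\<delta>..1}" "\<And>v. v \<in> {\<delta>..1} \<Longrightarrow> ?G u \<le> ?G v"
    using continuous_attains_inf[OF compact_Icc _ cont] \<delta> by auto
  have min: "?G u \<le> ?G v" if v: "0 < v" "v \<le> 1" for v
  proof (cases "\<delta> \<le> v")
    case True
    then show ?thesis using u v by simp
  next
    case False
    have "?G u \<le> ?G 1" using u \<delta> by simp
    also have "?G 1 = \<delta> powr (- \<alpha> * real h)"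
      using assms G1 by (simp add: \<delta>_def powr_powr)
    also have "\<dots> \<le> v powr (- \<alpha> * real h)"
      using False v \<delta> assms by (intro powr_mono2') auto
    also have "\<dots> = v powr (- \<alpha> * real h) * v ^ 0" by simp
    also have "\<dots> \<le> ?G v"
      unfolding G_fun_def using v by (intro mult_left_mono member_le_sum) auto
    finally show ?thesis .
  qed
  have "(LEAST v. v \<in> ?G ` {0<..1}) = ?G u"
    by (rule Least_equality) (use u \<delta> min in auto)
  then show thesis
    using that[of u] u \<delta> assms by (simp add: Lambda_min_def)
qed

text \<open>\<open>G_fun\<close> grows with \<open>m\<close>, so the bound for multiplicity 1
  implies the one for \<open>m\<close>. For \<open>\<alpha> = 0\<close> only the zero exponent
  vector is left, which matches the convention that \<open>Lambda_min\<close> is 1.\<close>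

lemma card_low_exponents_le_Lambda_min:
  assumes "\<alpha> \<ge> 0" "h > 0" "m \<ge> 1"
  shows "real (card (low_exponents h n \<alpha>)) \<le> Lambda_min m \<alpha> h ^ n"
proof (cases "\<alpha> = 0")
  case True
  have "low_exponents h n 0 \<subseteq> {\<lambda>j\<in>{..<n}. 0}"
    by (auto simp: low_exponents_def fun_eq_iff PiE_iff extensional_def simp flip: of_nat_sum)
  from card_mono[OF _ this] show ?thesis
    using True by (simp add: Lambda_min_def)
next
  case False
  with assms obtain u where u: "0 < u" "u \<le> 1" "Lambda_min m \<alpha> h = G_fun m \<alpha> h u"
    using Lambda_min_attained[of \<alpha> h m] by auto
  have "(\<Sum>k\<le>1 * h. u ^ k) \<le> (\<Sum>k\<le>m * h. u ^ k)"
    using u assms by (intro sum_mono2) auto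
  then have "G_fun 1 \<alpha> h u \<le> G_fun m \<alpha> h u"
    unfolding G_fun_def by (intro mult_left_mono) auto
  then have "G_fun 1 \<alpha> h u ^ n \<le> G_fun m \<alpha> h u ^ n"
    using u by (intro power_mono) (auto simp: G_fun_def intro!: mult_nonneg_nonneg sum_nonneg)
  with card_low_exponents_le[OF u(1,2), of h n \<alpha>] show ?thesis
    using u by simp
qed

text \<open>At \<open>u = 1\<close> the value is \<open>h + 1\<close> and the derivative is
  \<open>h * (h + 1) * (1 / 2 - \<alpha>) > 0\<close>, so slightly smaller \<open>u\<close> give
  smaller values.\<close>

lemma G_fun_below_trivial:
  assumes "\<alpha> < 1 / 2" "h > 0"
  obtains u where "0 < u" "u \<le> 1" "G_fun 1 \<alpha> h u < real h + 1"
proof -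
  let ?s = "- \<alpha> * real h"
  have gauss: "(\<Sum>k\<le>h. real k) = real h * (real h + 1) / 2"
    by (induction h) (auto simp: field_simps)
  have "(G_fun 1 \<alpha> h has_real_derivative (?s * (real h + 1) + (\<Sum>k\<le>h. real k))) (at 1)"
    unfolding G_fun_def[abs_def]
    by (rule derivative_eq_intros refl | simp)+
  moreover have "?s * (real h + 1) + (\<Sum>k\<le>h. real k) = real h * (real h + 1) * (1 / 2 - \<alpha>)"
    by (simp add: gauss field_simps)
  moreover have "\<dots> > 0" using assms by simp
  ultimately obtain d where d: "d > 0" "\<And>t. 0 < t \<Longrightarrow> t < d \<Longrightarrow> G_fun 1 \<alpha> h (1 - t) < G_fun 1 \<alpha> h 1"
    using DERIV_pos_inc_left by metis
  define t where "t = min (d / 2) (1 / 2)"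
  have "0 < t" "t < d" "t < 1" using d by (auto simp: t_def)
  then show thesis
    using that[of "1 - t"] d(2)[of t] by (simp add: G_fun_def)
qed

text \<open>Removes a constant factor in the tensor power trick: if \<open>a > b > 0\<close>, the
  powers of \<open>a / b\<close> outgrow \<open>C\<close>.\<close>

lemma le_if_powers_le:
  fixes a b :: real
  assumes "0 \<le> a" "0 \<le> b" "\<And>k. a ^ k \<le> C * b ^ k"
  shows "a \<le> b"
proof (rule ccontr)
  assume "\<not> a \<le> b"
  show False
  proof (cases "b = 0")
    case True
    then show False using assms(3)[of 1] \<open>\<not> a \<le> b\<close> by simp
  next
    case False
    then have "1 < a / b" using assms \<open>\<not> a \<le> b\<close> by simp
    then obtain k where "C < (a / b) ^ k" using real_arch_pow by blast
    then show False
      using assms(2) False assms(3)[of k] by (simp add: power_divide pos_less_divide_eq)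
  qed
qed

subsection \<open>Strongly free sets\<close>

lemma semishape_iff:
  assumes "A \<subseteq> carrier_vec n"
  shows "semishape T n A x \<longleftrightarrow> x \<in> {..<dim_col T} \<rightarrow> A \<and>
    (\<forall>l<dim_row T. \<forall>j<n. (\<Sum>i<dim_col T. T $$ (l, i) * x i $ j) = 0)"
proof (cases "x \<in> {..<dim_col T} \<rightarrow> A")
  case True
  then have x: "x i \<in> carrier_vec n" if "i < dim_col T" for i
    using assms that by auto
  have car: "(\<lambda>i. T $$ (l, i) \<cdot>\<^sub>v x i) \<in> {..<dim_col T} \<rightarrow> carrier_vec n" for l
    using x by auto
  have "finsum_vec TYPE('a) n (\<lambda>i. T $$ (l, i) \<cdot>\<^sub>v x i) {..<dim_col T} = 0\<^sub>v n \<longleftrightarrow>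
      (\<forall>j<n. (\<Sum>i<dim_col T. T $$ (l, i) * x i $ j) = 0)" for l
  proof -
    have "finsum_vec TYPE('a) n (\<lambda>i. T $$ (l, i) \<cdot>\<^sub>v x i) {..<dim_col T} \<in> carrier_vec n"
      by (rule finsum_vec_closed[OF car])
    moreover have "finsum_vec TYPE('a) n (\<lambda>i. T $$ (l, i) \<cdot>\<^sub>v x i) {..<dim_col T} $ j
        = (\<Sum>i<dim_col T. T $$ (l, i) * x i $ j)" if "j < n" for j
      using x that by (subst index_finsum_vec[OF _ that car]) (auto intro!: sum.cong index_smult_vec dest: carrier_vecD)
    ultimately show ?thesis by (auto simp: vec_eq_iff)
  qed
  then show ?thesis using True by (simp add: semishape_def)
qed (simp add: semishape_def)

text \<open>A solution in the product splits into one on the first \<open>n\<close> coordinates and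
  one on the last \<open>m\<close>; both are constant.\<close>

lemma strongly_free_append:
  assumes A: "A \<subseteq> carrier_vec n" "strongly_free T n A"
    and B: "B \<subseteq> carrier_vec m" "strongly_free T m B"
  shows "strongly_free T (n + m) ((\<lambda>(a, b). a @\<^sub>v b) ` (A \<times> B))"
  unfolding strongly_free_def
proof (intro allI impI)
  let ?C = "(\<lambda>(a, b). a @\<^sub>v b) ` (A \<times> B)"
  fix x i i' assume x: "semishape T (n + m) ?C x" and i: "i < dim_col T" "i' < dim_col T"
  have C: "?C \<subseteq> carrier_vec (n + m)" using A B by auto
  have sol: "(\<Sum>i<dim_col T. T $$ (l, i) * x i $ j) = 0" if "l < dim_row T" "j < n + m" for l j
    using x that by (simp add: semishape_iff[OF C])
  have "\<forall>i<dim_col T. \<exists>a b. a \<in> A \<and> b \<in> B \<and> x i = a @\<^sub>v b"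
    using x unfolding semishape_def Pi_iff by fast
  then obtain a b where ab: "\<And>i. i < dim_col T \<Longrightarrow> a i \<in> A \<and> b i \<in> B \<and> x i = a i @\<^sub>v b i"
    by metis
  have dim: "dim_vec (a i) = n" "dim_vec (b i) = m" if "i < dim_col T" for i
    using subsetD[OF A(1), of "a i"] subsetD[OF B(1), of "b i"] ab[OF that] by auto
  have "(\<Sum>i<dim_col T. T $$ (l, i) * a i $ j) = 0" if "l < dim_row T" "j < n" for l j
    using sol[OF that(1), of j] that ab dim by simp
  then have "semishape T n A a" using ab by (auto simp: semishape_iff[OF A(1)])
  moreover have "(\<Sum>i<dim_col T. T $$ (l, i) * b i $ j) = 0" if "l < dim_row T" "j < m" for l j
    using sol[OF that(1), of "n + j"] that ab dim by simp
  then have "semishape T m B b" using ab by (auto simp: semishape_iff[OF B(1)])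
  ultimately have "a i = a i'" "b i = b i'"
    using A B i unfolding strongly_free_def by blast+
  then show "x i = x i'" using ab i by metis
qed

lemma strongly_free_power:
  assumes A: "A \<subseteq> carrier_vec n" "strongly_free T n A"
  obtains B where "B \<subseteq> carrier_vec (k * n)" "strongly_free T (k * n) B" "card B = card A ^ k"
proof -
  have "\<exists>B. B \<subseteq> carrier_vec (k * n) \<and> strongly_free T (k * n) B \<and> card B = card A ^ k"
  proof (induction k)
    case 0
    have "strongly_free T 0 {vNil}" by (auto simp: strongly_free_def semishape_def Pi_iff)
    then show ?case by (intro exI[of _ "{vNil}"]) simp
  next
    case (Suc k)
    then obtain B where B: "B \<subseteq> carrier_vec (k * n)" "strongly_free T (k * n) B"
      "card B = card A ^ k" by blast
    have "inj_on (\<lambda>(a, b). a @\<^sub>v b) (A \<times> B)"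
      using A(1) by (auto simp: inj_on_def append_vec_eq[of _ n] subset_iff)
    then have "card ((\<lambda>(a, b). a @\<^sub>v b) ` (A \<times> B)) = card A ^ Suc k"
      by (simp add: card_image card_cartesian_product B)
    moreover have "(\<lambda>(a, b). a @\<^sub>v b) ` (A \<times> B) \<subseteq> carrier_vec (n + k * n)"
      using A B by auto
    ultimately show ?case
      using strongly_free_append[OF A B(1,2)]
      by (intro exI[of _ "(\<lambda>(a, b). a @\<^sub>v b) ` (A \<times> B)"]) simp
  qed
  then show thesis using that by blast
qed

section \<open>Upper bounds for the extremal number\<close>

lemma finite_carrier_vec: "finite (carrier_vec n :: 'a::finite vec set)"
proof (rule finite_subset)
  show "carrier_vec n \<subseteq> vec n ` ({..<n} \<rightarrow>\<^sub>E (UNIV :: 'a set))"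
  proof
    fix v :: "'a vec" assume "v \<in> carrier_vec n"
    then have "v = vec n (\<lambda>i\<in>{..<n}. v $ i)" by auto
    then show "v \<in> vec n ` ({..<n} \<rightarrow>\<^sub>E UNIV)" by (metis image_eqI restrict_PiE_iff UNIV_I)
  qed
qed (intro finite_imageI finite_PiE, auto)

lemma ex_free_attained:
  fixes T :: "'a::{field,finite} mat"
  obtains A where "A \<subseteq> carrier_vec n" "strongly_free T n A" "card A = ex_free T n"
proof -
  let ?X = "{card A |A. A \<subseteq> carrier_vec n \<and> strongly_free T n A}"
  have "?X \<subseteq> card ` Pow (carrier_vec n :: 'a vec set)" by auto
  then have "finite ?X"
    by (rule finite_subset) (simp add: finite_carrier_vec)
  moreover have "strongly_free T n {}"
    by (auto simp: strongly_free_def semishape_def Pi_iff)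
  then have "?X \<noteq> {}" by blast
  ultimately have "Max ?X \<in> ?X" by (rule Max_in)
  then show thesis using that by (auto simp: ex_free_def)
qed

text \<open>Balance makes every constant tuple a solution and strong freeness excludes all others,
  so on \<open>A\<close> the indicator is the diagonal tensor with weights 1. The weights
  \<open>\<alpha> i\<close> distribute its degree among the variables.\<close>

lemma card_strongly_free_le_sum:
  fixes T :: "'a::{field,finite} mat"
  assumes A: "A \<subseteq> carrier_vec n" "strongly_free T n A" and bal: "balanced_system T"
    and r: "dim_col T \<ge> 2" and \<alpha>: "(\<Sum>i<dim_col T. \<alpha> i) = real (dim_row T)"
  shows "card A \<le> (\<Sum>i<dim_col T. card (low_exponents (CARD('a) - 1) n (\<alpha> i)))"
proof -
  let ?r = "dim_col T"
  have fin: "finite A" by (rule finite_subset[OF A(1) finite_carrier_vec])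
  have "real (dim_row T * n * (CARD('a) - 1)) \<le> (\<Sum>i<?r. \<alpha> i) * real n * real (CARD('a) - 1)"
    by (simp add: \<alpha>)
  from poly_fun_slices[OF poly_fun_solution_indicator _ this] r
  obtain g where g: "\<forall>i t x v. g i t (x(i := v)) = g i t x"
    "\<forall>x. solution_indicator T n x = (\<Sum>i<?r. \<Sum>t\<in>low_exponents (CARD('a) - 1) n (\<alpha> i).
        (\<Prod>j<n. (x i $ j) ^ t j) * g i t x)"
    by fastforce
  show ?thesis
  proof (rule slice_rank_diagonal[where w = "\<lambda>_. 1 :: 'a" and g = g
        and f = "\<lambda>i t v. \<Prod>j<n. (v $ j) ^ t j"])
    fix x assume x: "x \<in> {..<?r} \<rightarrow> A"
    have "solution_indicator T n x = (\<Sum>a\<in>A. \<Prod>i<?r. of_bool (x i = a))"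
    proof (cases "\<forall>i<?r. x i = x 0")
      case True
      have sol: "(\<Sum>i<?r. T $$ (l, i) * x i $ j) = 0" if "l < dim_row T" for l j
      proof -
        have "(\<Sum>i<?r. T $$ (l, i) * x i $ j) = (\<Sum>i<?r. T $$ (l, i) * x 0 $ j)"
          using True by (intro sum.cong refl) (metis lessThan_iff)
        also have "\<dots> = (\<Sum>i<?r. T $$ (l, i)) * x 0 $ j" by (simp add: sum_distrib_right)
        finally show ?thesis using bal that by (simp add: balanced_system_def)
      qed
      have "0 < ?r" using r by simp
      then have x0: "x 0 \<in> A" using x by auto
      have "(\<Prod>i<?r. of_bool (x i = a)) = (of_bool (x 0 = a) :: 'a)" for a
      proof -
        have "(\<Prod>i<?r. of_bool (x i = a)) = (\<Prod>i<?r. of_bool (x 0 = a) :: 'a)"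
          using True by (intro prod.cong refl) (metis lessThan_iff)
        then show ?thesis using r by (simp add: of_bool_def)
      qed
      then show ?thesis
        using sol x0 fin by (simp add: solution_indicator_eq of_bool_def)
    next
      case False
      then obtain i where i: "i < ?r" "x i \<noteq> x 0" by blast
      have "\<not> semishape T n A x"
        using A(2) i unfolding strongly_free_def by (metis gr_implies_not0 neq0_conv)
      then have "solution_indicator T n x = 0"
        using x by (auto simp: semishape_iff[OF A(1)] solution_indicator_eq)
      \<comment> \<open>Since \<open>x i\<close> and \<open>x 0\<close> differ, one of them is not
        \<open>a\<close> and gives a zero factor.\<close>
      moreover have "(\<Prod>i<?r. of_bool (x i = a)) = (0 :: 'a)" for a
      proof (cases "x i = a")
        case True
        then show ?thesis using i by (intro prod_zero) (auto intro!: bexI[of _ 0])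
      next
        case False
        then show ?thesis using i by (intro prod_zero) (auto intro!: bexI[of _ i])
      qed
      ultimately show ?thesis by (simp only: sum.neutral_const)
    qed
    then show "(\<Sum>a\<in>A. 1 * (\<Prod>i<?r. of_bool (x i = a)))
      = (\<Sum>i<?r. \<Sum>t\<in>low_exponents (CARD('a) - 1) n (\<alpha> i). (\<Prod>j<n. (x i $ j) ^ t j) * g i t x)"
      using g(2) by simp
  qed (use g(1) r fin in \<open>simp_all add: finite_low_exponents\<close>)
qed

text \<open>The bound on \<open>M\<close> is assumed for all lengths because it is applied at
  \<open>k * n\<close> for every power \<open>k\<close> of \<open>A\<close>.\<close>

lemma card_strongly_free_le_power:
  fixes T :: "'a::{field,finite} mat"
  assumes A: "A \<subseteq> carrier_vec n" "strongly_free T n A" and bal: "balanced_system T"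
    and r: "dim_col T \<ge> 2" and \<alpha>: "(\<Sum>i<dim_col T. \<alpha> i) = real (dim_row T)"
    and M: "\<And>i n. i < dim_col T \<Longrightarrow> real (card (low_exponents (CARD('a) - 1) n (\<alpha> i))) \<le> M ^ n"
  shows "real (card A) \<le> M ^ n"
proof (rule le_if_powers_le)
  have "0 \<le> M" using M[of 0 1] r by (simp add: order.trans[OF of_nat_0_le_iff])
  then show "0 \<le> M ^ n" by simp
  \<comment> \<open>tensor power trick: the bound for the \<open>k\<close>-th power of \<open>A\<close> removes the factor \<open>dim_col T\<close>\<close>
  show "real (card A) ^ k \<le> real (dim_col T) * (M ^ n) ^ k" for k
  proof -
    obtain B where B: "B \<subseteq> carrier_vec (k * n)" "strongly_free T (k * n) B" "card B = card A ^ k"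
      by (rule strongly_free_power[OF A])
    have "real (card A) ^ k = real (card B)" by (simp add: B)
    also have "\<dots> \<le> real (\<Sum>i<dim_col T. card (low_exponents (CARD('a) - 1) (k * n) (\<alpha> i)))"
      using card_strongly_free_le_sum[OF B(1,2) bal r \<alpha>] by (simp only: of_nat_le_iff)
    also have "\<dots> \<le> (\<Sum>i<dim_col T. M ^ (k * n))"
      unfolding of_nat_sum using M by (intro sum_mono) auto
    finally show ?thesis by (simp add: mult.commute[of k] power_mult)
  qed
qed simp

lemma ex_free_le_power:
  fixes T :: "'a::{field,finite} mat"
  assumes "balanced_system T" "dim_col T \<ge> 2" "(\<Sum>i<dim_col T. \<alpha> i) = real (dim_row T)"
    and "\<And>i n. i < dim_col T \<Longrightarrow> real (card (low_exponents (CARD('a) - 1) n (\<alpha> i))) \<le> M ^ n"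
  shows "real (ex_free T n) \<le> M ^ n"
proof -
  obtain A where "A \<subseteq> carrier_vec n" "strongly_free T n A" "card A = ex_free T n"
    by (rule ex_free_attained)
  with card_strongly_free_le_power[OF _ _ assms, of A n] show ?thesis by simp
qed

section \<open>Choice of the weights and of the constant\<close>

theorem theoremA:
  fixes p L r :: nat and T :: "'a::{field,finite} mat"
  assumes "prime p" and "CARD('a) = p"
    and "T \<in> carrier_mat L r"
    and "balanced_system T" and "irreducible_system T"
    and "1 / 2 * real (num_mult_one T) + 1 / exp 1 * real (num_mult_ge_two T) > real L"
  shows "\<exists>c::real. c < 1 \<and>
           c \<le> C_tilde (num_mult_one T) (num_mult_ge_two T) L (max_multiplicity T) p / real p \<and>
           (\<forall>n::nat. real (ex_free T n) \<le> (c * real p) ^ n)"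
proof -
  let ?r1 = "num_mult_one T" and ?r2 = "num_mult_ge_two T" and ?m = "max_multiplicity T"
  let ?C = "C_tilde ?r1 ?r2 L ?m p"
  have dims: "dim_row T = L" "dim_col T = r" using assms by auto
  have p: "p \<ge> 2" using assms prime_ge_2_nat by simp
  have vert: "\<exists>l<L. T $$ (l, i) \<noteq> 0" if "i < r" for i
    using assms that dims by (auto simp: irreducible_system_def system_vertices_def eq_support_def)
  have mult: "var_multiplicity T i \<ge> 1" if i: "i < r" for i
  proof -
    have "{l. l < dim_row T \<and> T $$ (l, i) \<noteq> 0} \<noteq> {}" using vert[OF i] dims by auto
    then show ?thesis by (simp add: var_multiplicity_def Suc_le_eq card_gt_0_iff)
  qed
  define I1 where "I1 = {i. i < r \<and> var_multiplicity T i = 1}"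
  define I2 where "I2 = {i. i < r \<and> var_multiplicity T i \<ge> 2}"
  have I: "{..<r} = I1 \<union> I2" "I1 \<inter> I2 = {}" "finite I1" "finite I2"
    using mult by (force simp: I1_def I2_def)+
  have r12: "?r1 = card I1" "?r2 = card I2"
    by (simp_all add: num_mult_one_def num_mult_ge_two_def I1_def I2_def dims)
  have r: "r = ?r1 + ?r2" using card_Un_disjoint[OF I(3,4,2)] I(1) r12 by (metis card_lessThan)
  have "r \<noteq> 0" using assms(6) r by (cases "r = 0") auto
  \<comment> \<open>A slice rank bound needs two variables. With only one, balance would make its
    coefficient zero in every equation.\<close>
  have "r \<noteq> 1"
  proof
    assume "r = 1"
    then obtain l where "l < L" "T $$ (l, 0) \<noteq> 0" using vert[of 0] by auto
    then show False using assms(4) dims \<open>r = 1\<close> by (auto simp: balanced_system_def)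
  qed
  with \<open>r \<noteq> 0\<close> have r2: "dim_col T \<ge> 2" using dims by simp
  have L: "L > 0" using vert[of 0] \<open>r \<noteq> 0\<close> by auto
  have m: "?m \<ge> 1"
    using mult[of 0] \<open>r \<noteq> 0\<close> unfolding max_multiplicity_def dims
    by (auto simp: Max_ge_iff intro: order.trans)
  \<comment> \<open>Variables of multiplicity one get weight \<alpha>, the others \<beta>; the
    constraint in \<open>C_tilde\<close> says that these weights sum to \<open>L\<close>.\<close>
  have bound: "real (ex_free T n) \<le> max (Lambda_min 1 \<alpha> (p - 1)) (Lambda_min ?m \<beta> (p - 1)) ^ n"
    if ab: "real ?r1 * \<alpha> + real ?r2 * \<beta> = real L" "\<alpha> \<ge> 0" "\<beta> \<ge> 0" for \<alpha> \<beta> n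
  proof (rule ex_free_le_power[OF assms(4) r2, where \<alpha> = "\<lambda>i. if i \<in> I1 then \<alpha> else \<beta>"])
    have "(\<Sum>i\<in>I2. if i \<in> I1 then \<alpha> else \<beta>) = (\<Sum>i\<in>I2. \<beta>)"
      using I by (intro sum.cong) auto
    then show "(\<Sum>i<dim_col T. if i \<in> I1 then \<alpha> else \<beta>) = real (dim_row T)"
      using I ab by (simp add: dims sum.union_disjoint r12)
    show "real (card (low_exponents (CARD('a) - 1) n (if i \<in> I1 then \<alpha> else \<beta>)))
      \<le> max (Lambda_min 1 \<alpha> (p - 1)) (Lambda_min ?m \<beta> (p - 1)) ^ n" for i n
    proof -
      have le: "real (card (low_exponents (p - 1) n \<alpha>)) \<le> Lambda_min 1 \<alpha> (p - 1) ^ n"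
        "real (card (low_exponents (p - 1) n \<beta>)) \<le> Lambda_min ?m \<beta> (p - 1) ^ n" for n
        using p m ab by (auto intro!: card_low_exponents_le_Lambda_min)
      have "0 \<le> Lambda_min 1 \<alpha> (p - 1)" "0 \<le> Lambda_min ?m \<beta> (p - 1)"
        using le[of 1] by (auto intro: order.trans[OF of_nat_0_le_iff])
      then have "Lambda_min 1 \<alpha> (p - 1) ^ n \<le> max (Lambda_min 1 \<alpha> (p - 1)) (Lambda_min ?m \<beta> (p - 1)) ^ n"
        "Lambda_min ?m \<beta> (p - 1) ^ n \<le> max (Lambda_min 1 \<alpha> (p - 1)) (Lambda_min ?m \<beta> (p - 1)) ^ n"
        by (auto intro!: power_mono)
      then show ?thesis using le[of n] assms(2) by auto
    qed
  qed
  \<comment> \<open>The equal weights are an admissible pair, so the infimum is over a nonempty set;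
    they also give the second bound below.\<close>
  define \<gamma> where "\<gamma> = real L / real r"
  have "real ?r1 * \<gamma> + real ?r2 * \<gamma> = real r * \<gamma>"
    by (simp add: r distrib_right)
  then have \<gamma>: "\<gamma> > 0" "(\<Sum>i<dim_col T. \<gamma>) = real (dim_row T)"
    "real ?r1 * \<gamma> + real ?r2 * \<gamma> = real L"
    using L \<open>r \<noteq> 0\<close> by (simp_all add: \<gamma>_def dims)
  \<comment> \<open>Taking \<open>n\<close>-th roots turns the bounds for all pairs into a lower
    bound of the set defining \<open>C_tilde\<close>. The case \<open>n = 0\<close> has no such root
    and is treated apart.\<close>
  have C: "real (ex_free T n) \<le> ?C ^ n" for n
  proof (cases "n = 0")
    case True
    then show ?thesis using bound[OF \<gamma>(3), of 0] \<gamma>(1) by simp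
  next
    case False
    have "root n (real (ex_free T n)) \<le> ?C"
      unfolding C_tilde_def
    proof (rule cInf_greatest)
      show "{max (Lambda_min 1 \<alpha> (p - 1)) (Lambda_min ?m \<beta> (p - 1)) |\<alpha> \<beta>.
          real ?r1 * \<alpha> + real ?r2 * \<beta> = real L \<and> 0 \<le> \<alpha> \<and> 0 \<le> \<beta>} \<noteq> {}"
        using \<gamma> less_imp_le by blast
    next
      fix y assume "y \<in> {max (Lambda_min 1 \<alpha> (p - 1)) (Lambda_min ?m \<beta> (p - 1)) |\<alpha> \<beta>.
          real ?r1 * \<alpha> + real ?r2 * \<beta> = real L \<and> 0 \<le> \<alpha> \<and> 0 \<le> \<beta>}"
      then have y: "real (ex_free T k) \<le> y ^ k" for k using bound by blast
      have "0 \<le> y" using y[of 1] by (auto intro: order.trans[OF of_nat_0_le_iff])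
      have "root n (real (ex_free T n)) \<le> root n (y ^ n)"
        using False y by (simp add: real_root_le_mono)
      then show "root n (real (ex_free T n)) \<le> y"
        using False \<open>0 \<le> y\<close> by (simp add: real_root_power_cancel)
    qed
    then have "root n (real (ex_free T n)) ^ n \<le> ?C ^ n" by (intro power_mono) (simp_all add: real_root_ge_zero)
    then show ?thesis using False by simp
  qed
  \<comment> \<open>As e is at least 2, the hypothesis gives \<open>L < r / 2\<close>, which puts
    \<gamma> below the threshold of \<open>G_fun_below_trivial\<close>.\<close>
  have "real L < 1 / 2 * real ?r1 + 1 / 2 * real ?r2"
  proof -
    have "1 / exp 1 * real ?r2 \<le> 1 / 2 * real ?r2"
      using exp_ge_add_one_self[of 1] by (intro mult_right_mono) (auto simp: field_simps)
    then show ?thesis using assms(6) by linarith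
  qed
  then have "\<gamma> < 1 / 2"
    using \<open>r \<noteq> 0\<close> r by (simp add: \<gamma>_def field_simps)
  then obtain u where u: "0 < u" "u \<le> 1" "G_fun 1 \<gamma> (p - 1) u < real (p - 1) + 1"
    using G_fun_below_trivial[of \<gamma> "p - 1"] p by auto
  have G: "real (ex_free T n) \<le> G_fun 1 \<gamma> (p - 1) u ^ n" for n
    using card_low_exponents_le[OF u(1,2)] assms(2)
    by (intro ex_free_le_power[OF assms(4) r2 \<gamma>(2)]) auto
  \<comment> \<open>Both bounds hold for every \<open>n\<close>, hence so does the smaller one. The
    comparison with \<open>C_tilde\<close> comes from one entry of the minimum, the strict bound
    \<open>c < 1\<close> from the other.\<close>
  have "min ?C (G_fun 1 \<gamma> (p - 1) u) / real p < 1"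
    using u p by (auto simp: min_def of_nat_diff)
  moreover have "min ?C (G_fun 1 \<gamma> (p - 1) u) / real p \<le> ?C / real p"
    by (intro divide_right_mono) auto
  moreover have "real (ex_free T n) \<le> (min ?C (G_fun 1 \<gamma> (p - 1) u) / real p * real p) ^ n" for n
    using C G p by (simp add: min_def)
  ultimately show ?thesis by blast
qed

end
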